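(* $\mathrm{NestedCollision}\le_T\mathrm{Collision}$, i.e., the search problem $\mathrm{NestedCollision}$ is Turing reducible to the search problem $\mathrm{Collision}$.
   Context: $\mathrm{Collision}$: an instance is a Boolean circuit $C\colon\{0,1\}^n\to\{0,1\}^{n-1}$; a solution is a pair $x_1,x_2\in\{0,1\}^n$ with $x_1\neq x_2$ and $C(x_1)=C(x_2)$. $\mathrm{NestedCollision}$: an instance is a pair of Boolean circuits $f\colon\{0,1\}^n\to\{0,1\}^{n-1}$ and $g\colon\{0,1\}^{2n}\times\{0,1\}^n\to\{0,1\}^{n-1}$, where $\{0,1\}^{2n}$ is identified with $(\{0,1\}^n)^2$ blockwise. A solution is a tuple $(x,y,u,v)\in(\{0,1\}^n)^4$ such that $x\ne y$, $f(x)=f(y)$, $u\ne v$, and $g(x,y,u)=g(x,y,v)$. $A$ is Turing reducible to $B$ (written $A\le_T B$), for total $\mathsf{NP}$ search problems $A,B$, if there exists a polynomial-time oracle Turing machine that solves $A$ by making multiple, sequential queries to an oracle for $B$ (which returns some solution of the queried instance), where the input to each query can depend on the answers received from previous ones. *)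

theory Defs
  imports Main "HOL-Computational_Algebra.Polynomial"
begin

section \<open>Boolean circuits\<close>

type_synonym bits = "bool list"

text \<open>
  A circuit is a directed acyclic graph, given by a topologically sorted list of its nodes.
  The argument of \<^term>\<open>Inp\<close> is the index of an input bit; the arguments of \<^term>\<open>Not\<close>, \<^term>\<open>And\<close>
  and \<^term>\<open>Or\<close> are positions of earlier nodes in the list.
\<close>

datatype gate = Inp nat | Const bool | Not nat | And nat nat | Or nat nat

datatype circuit = Circuit (n_inputs: nat) (gates: "gate list") (outputs: "nat list")

fun wf_gate :: "nat \<Rightarrow> nat \<Rightarrow> gate \<Rightarrow> bool" where
  "wf_gate n k (Inp i) \<longleftrightarrow> i < n"
| "wf_gate n k (Const b) \<longleftrightarrow> True"
| "wf_gate n k (Not i) \<longleftrightarrow> i < k"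
| "wf_gate n k (And i j) \<longleftrightarrow> i < k \<and> j < k"
| "wf_gate n k (Or i j) \<longleftrightarrow> i < k \<and> j < k"

definition is_circuit :: "nat \<Rightarrow> nat \<Rightarrow> circuit \<Rightarrow> bool" where
  "is_circuit n m C \<longleftrightarrow>
     n_inputs C = n \<and> length (outputs C) = m \<and>
     (\<forall>k < length (gates C). wf_gate n k (gates C ! k)) \<and>
     (\<forall>j \<in> set (outputs C). j < length (gates C))"

fun gate_value :: "bits \<Rightarrow> bits \<Rightarrow> gate \<Rightarrow> bool" where
  "gate_value x vs (Inp i) = x ! i"
| "gate_value x vs (Const b) = b"
| "gate_value x vs (Not i) = (\<not> vs ! i)"
| "gate_value x vs (And i j) = (vs ! i \<and> vs ! j)"
| "gate_value x vs (Or i j) = (vs ! i \<or> vs ! j)"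

definition gate_values :: "bits \<Rightarrow> gate list \<Rightarrow> bits" where
  "gate_values x gs = foldl (\<lambda>vs g. vs @ [gate_value x vs g]) [] gs"

definition eval_circuit :: "circuit \<Rightarrow> bits \<Rightarrow> bits" where
  "eval_circuit C x = map (\<lambda>j. gate_values x (gates C) ! j) (outputs C)"


section \<open>Encoding of circuits as bit strings\<close>

text \<open>
  Numbers are written in unary. All indices in a circuit are bounded by its number of inputs or of
  nodes, so the code length is polynomial in the size of the circuit (inputs, nodes and outputs).
\<close>

definition encode_nat :: "nat \<Rightarrow> bits" where
  "encode_nat n = replicate n True @ [False]"

definition encode_list :: "('a \<Rightarrow> bits) \<Rightarrow> 'a list \<Rightarrow> bits" where
  "encode_list e xs = concat (map (\<lambda>x. True # e x) xs) @ [False]"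

fun encode_gate :: "gate \<Rightarrow> bits" where
  "encode_gate (Inp i) = [False, False] @ encode_nat i"
| "encode_gate (Const b) = [False, True, b]"
| "encode_gate (Not i) = [True, False] @ encode_nat i"
| "encode_gate (And i j) = [True, True, False] @ encode_nat i @ encode_nat j"
| "encode_gate (Or i j) = [True, True, True] @ encode_nat i @ encode_nat j"

definition encode_circuit :: "circuit \<Rightarrow> bits" where
  "encode_circuit C =
     encode_nat (n_inputs C) @ encode_list encode_gate (gates C) @ encode_list encode_nat (outputs C)"

lemma encode_nat_prefix_free:
  "encode_nat m @ r = encode_nat n @ s \<Longrightarrow> m = n \<and> r = s"
proof (induction m arbitrary: n)
  case 0
  then show ?case by (cases n) (auto simp: encode_nat_def)
next
  case (Suc m)
  then show ?case by (cases n) (auto simp: encode_nat_def)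
qed

lemma encode_gate_prefix_free:
  "encode_gate g @ r = encode_gate h @ s \<Longrightarrow> g = h \<and> r = s"
  by (cases g; cases h) (auto dest!: encode_nat_prefix_free)

lemma encode_list_prefix_free:
  assumes "\<And>x y r s. e x @ r = e y @ s \<Longrightarrow> x = y \<and> r = s"
  shows "encode_list e xs @ r = encode_list e ys @ s \<Longrightarrow> xs = ys \<and> r = s"
proof (induction xs arbitrary: ys)
  case Nil
  then show ?case by (cases ys) (auto simp: encode_list_def)
next
  case (Cons x xs)
  then show ?case by (cases ys) (auto simp: encode_list_def dest!: assms)
qed

lemma encode_circuit_prefix_free:
  assumes "encode_circuit C @ r = encode_circuit D @ s"
  shows "C = D \<and> r = s"
proof -
  have "encode_nat (n_inputs C) @ encode_list encode_gate (gates C) @ encode_list encode_nat (outputs C) @ r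
      = encode_nat (n_inputs D) @ encode_list encode_gate (gates D) @ encode_list encode_nat (outputs D) @ s"
    using assms by (simp add: encode_circuit_def)
  then have n: "n_inputs C = n_inputs D"
    and "encode_list encode_gate (gates C) @ encode_list encode_nat (outputs C) @ r
      = encode_list encode_gate (gates D) @ encode_list encode_nat (outputs D) @ s"
    by (auto dest: encode_nat_prefix_free)
  from encode_list_prefix_free[OF encode_gate_prefix_free this(2)]
  have g: "gates C = gates D"
    and "encode_list encode_nat (outputs C) @ r = encode_list encode_nat (outputs D) @ s"
    by auto
  from encode_list_prefix_free[OF encode_nat_prefix_free this(2)] n g
  show ?thesis by (auto intro: circuit.expand)
qed


section \<open>Search problems\<close>

record search_problem =
  instances :: "bits set"
  solutions :: "bits \<Rightarrow> bits set"

definition Collision :: search_problem where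
  "Collision = \<lparr>
     instances = {encode_circuit C | n C. 1 \<le> n \<and> is_circuit n (n - 1) C},
     solutions = (\<lambda>w. {x1 @ x2 | n C x1 x2.
        1 \<le> n \<and> is_circuit n (n - 1) C \<and> w = encode_circuit C \<and>
        length x1 = n \<and> length x2 = n \<and>
        x1 \<noteq> x2 \<and> eval_circuit C x1 = eval_circuit C x2}) \<rparr>"

definition NestedCollision :: search_problem where
  "NestedCollision = \<lparr>
     instances = {encode_circuit f @ encode_circuit g | n f g.
        1 \<le> n \<and> is_circuit n (n - 1) f \<and> is_circuit (2 * n + n) (n - 1) g},
     solutions = (\<lambda>w. {x @ y @ u @ v | n f g x y u v.
        1 \<le> n \<and> is_circuit n (n - 1) f \<and> is_circuit (2 * n + n) (n - 1) g \<and>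
        w = encode_circuit f @ encode_circuit g \<and>
        length x = n \<and> length y = n \<and> length u = n \<and> length v = n \<and>
        x \<noteq> y \<and> eval_circuit f x = eval_circuit f y \<and>
        u \<noteq> v \<and> eval_circuit g (x @ y @ u) = eval_circuit g (x @ y @ v)}) \<rparr>"

definition total_search_problem :: "search_problem \<Rightarrow> bool" where
  "total_search_problem A \<longleftrightarrow> (\<forall>w \<in> instances A. solutions A w \<noteq> {})"

lemma pigeonhole_bits:
  fixes F :: "bits \<Rightarrow> bits"
  assumes "1 \<le> n" and "\<And>x. length (F x) = n - 1"
  obtains x y where "length x = n" "length y = n" "x \<noteq> y" "F x = F y"
proof -
  let ?X = "\<lambda>k. {xs :: bits. length xs = k}"
  have fin: "finite (?X k)" and card: "card (?X k) = 2 ^ k" for k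
    using finite_lists_length_eq[of "UNIV :: bool set" k] card_lists_length_eq[of "UNIV :: bool set" k]
    by (simp_all add: card_UNIV_bool)
  have "card (F ` ?X n) \<le> card (?X (n - 1))"
    by (rule card_mono) (use fin assms in auto)
  also have "\<dots> < card (?X n)"
    using assms(1) by (simp only: card) (simp add: power_strict_increasing)
  finally have "\<not> inj_on F (?X n)" by (rule pigeonhole)
  then show ?thesis using that by (auto simp: inj_on_def)
qed

lemma total_Collision: "total_search_problem Collision"
  unfolding total_search_problem_def
proof
  fix w assume "w \<in> instances Collision"
  then obtain n C where C: "1 \<le> n" "is_circuit n (n - 1) C" "w = encode_circuit C"
    by (auto simp: Collision_def)
  obtain x y where "length x = n" "length y = n" "x \<noteq> y" "eval_circuit C x = eval_circuit C y"
    by (rule pigeonhole_bits[OF C(1), of "eval_circuit C"])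
      (use C(2) in \<open>auto simp: eval_circuit_def is_circuit_def\<close>)
  with C have "x @ y \<in> solutions Collision w"
    by (fastforce simp: Collision_def)
  then show "solutions Collision w \<noteq> {}" by blast
qed

lemma total_NestedCollision: "total_search_problem NestedCollision"
  unfolding total_search_problem_def
proof
  fix w assume "w \<in> instances NestedCollision"
  then obtain n f g where fg: "1 \<le> n" "is_circuit n (n - 1) f" "is_circuit (2 * n + n) (n - 1) g"
      "w = encode_circuit f @ encode_circuit g"
    by (auto simp: NestedCollision_def)
  obtain x y where xy: "length x = n" "length y = n" "x \<noteq> y" "eval_circuit f x = eval_circuit f y"
    by (rule pigeonhole_bits[OF fg(1), of "eval_circuit f"])
      (use fg(2) in \<open>auto simp: eval_circuit_def is_circuit_def\<close>)
  obtain u v where uv: "length u = n" "length v = n" "u \<noteq> v"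
      "eval_circuit g (x @ y @ u) = eval_circuit g (x @ y @ v)"
    by (rule pigeonhole_bits[OF fg(1), of "\<lambda>u. eval_circuit g (x @ y @ u)"])
      (use fg(3) in \<open>auto simp: eval_circuit_def is_circuit_def\<close>)
  have "x @ y @ u @ v \<in> solutions NestedCollision w"
    unfolding NestedCollision_def search_problem.simps mem_Collect_eq
    using fg xy uv by blast
  then show "solutions NestedCollision w \<noteq> {}" by blast
qed


section \<open>Oracle Turing machines\<close>

text \<open>
  Deterministic multi-tape machines; tapes are infinite in both directions.
  Tape symbols are natural numbers below \<^term>\<open>alphabet_size\<close>: 0 is the blank,
  1 and 2 are the bits \<^term>\<open>False\<close> and \<^term>\<open>True\<close>, the others are auxiliary symbols.
  Tape 0 holds the input, tape 1 the oracle queries, tape 2 the oracle answers and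
  tape 3 the output; further tapes are work tapes.
\<close>

datatype move = MoveLeft | Stay | MoveRight

record oracle_tm =
  n_tapes :: nat
  n_states :: nat
  alphabet_size :: nat
  start_state :: nat
  query_state :: nat
  answer_state :: nat
  halt_state :: nat
  delta :: "nat \<Rightarrow> nat list \<Rightarrow> nat \<times> (nat \<times> move) list"

definition wf_oracle_tm :: "oracle_tm \<Rightarrow> bool" where
  "wf_oracle_tm M \<longleftrightarrow>
     4 \<le> n_tapes M \<and> 3 \<le> alphabet_size M \<and>
     start_state M < n_states M \<and> query_state M < n_states M \<and>
     answer_state M < n_states M \<and> halt_state M < n_states M \<and>
     query_state M \<noteq> halt_state M \<and>
     (\<forall>q ss. q < n_states M \<and> length ss = n_tapes M \<and> (\<forall>s \<in> set ss. s < alphabet_size M) \<longrightarrow>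
        fst (delta M q ss) < n_states M \<and>
        length (snd (delta M q ss)) = n_tapes M \<and>
        (\<forall>(s, d) \<in> set (snd (delta M q ss)). s < alphabet_size M))"

text \<open>A tape is given by the contents of its cells and the position of the head.\<close>

type_synonym tape = "(int \<Rightarrow> nat) \<times> int"

type_synonym config = "nat \<times> tape list"

definition read_symbol :: "tape \<Rightarrow> nat" where
  "read_symbol t = fst t (snd t)"

fun move_offset :: "move \<Rightarrow> int" where
  "move_offset MoveLeft = - 1"
| "move_offset Stay = 0"
| "move_offset MoveRight = 1"

definition act :: "tape \<Rightarrow> nat \<times> move \<Rightarrow> tape" where
  "act t a = ((fst t)(snd t := fst a), snd t + move_offset (snd a))"

definition bit_symbol :: "bool \<Rightarrow> nat" where
  "bit_symbol b = (if b then 2 else 1)"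

definition tape_of_bits :: "bits \<Rightarrow> tape" where
  "tape_of_bits w =
     ((\<lambda>i. if 0 \<le> i \<and> i < int (length w) then bit_symbol (w ! nat i) else 0), 0)"

text \<open>
  The word on a tape extends from cell 0 to the first cell that does not contain a bit,
  irrespective of the head position.
\<close>

definition bits_of_tape :: "tape \<Rightarrow> bits" where
  "bits_of_tape t =
     map (\<lambda>i. fst t (int i) = bit_symbol True)
       [0..<(LEAST k. fst t (int k) \<notin> range bit_symbol)]"

definition initial_config :: "oracle_tm \<Rightarrow> bits \<Rightarrow> config" where
  "initial_config M w = (start_state M, tape_of_bits w # replicate (n_tapes M - 1) (tape_of_bits []))"

text \<open>
  A query takes a single step, in which the oracle answer overwrites the answer tape, the query
  tape is erased and the heads of these two tapes return to cell 0.
\<close>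

definition step :: "oracle_tm \<Rightarrow> (bits \<Rightarrow> bits) \<Rightarrow> config \<Rightarrow> config" where
  "step M \<O> = (\<lambda>(q, ts).
     if q = halt_state M then (q, ts)
     else if q = query_state M then
       (answer_state M, ts[1 := tape_of_bits [], 2 := tape_of_bits (\<O> (bits_of_tape (ts ! 1)))])
     else
       (let (q', as) = delta M q (map read_symbol ts) in (q', map2 act ts as)))"

definition computes_within :: "oracle_tm \<Rightarrow> (bits \<Rightarrow> bits) \<Rightarrow> bits \<Rightarrow> nat \<Rightarrow> bits \<Rightarrow> bool" where
  "computes_within M \<O> w T z \<longleftrightarrow>
     (\<exists>t \<le> T. \<exists>ts. (step M \<O> ^^ t) (initial_config M w) = (halt_state M, ts) \<and>
        bits_of_tape (ts ! 3) = z)"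


section \<open>Turing reducibility\<close>

text \<open>The answers to queries that are not instances are unconstrained.\<close>

definition is_oracle_for :: "(bits \<Rightarrow> bits) \<Rightarrow> search_problem \<Rightarrow> bool" where
  "is_oracle_for \<O> B \<longleftrightarrow> (\<forall>w \<in> instances B. \<O> w \<in> solutions B w)"

definition turing_reducible :: "search_problem \<Rightarrow> search_problem \<Rightarrow> bool"  (infix \<open>\<le>\<^sub>T\<close> 50) where
  "A \<le>\<^sub>T B \<longleftrightarrow>
     (\<exists>M (p :: nat poly). wf_oracle_tm M \<and>
        (\<forall>\<O>. is_oracle_for \<O> B \<longrightarrow>
           (\<forall>w \<in> instances A. \<exists>z \<in> solutions A w. computes_within M \<O> w (poly p (length w)) z)))"

end

theory Submission
  imports Defs
begin

text \<open>
  Query the oracle on \<open>f\<close> to get a collision \<open>x, y\<close>, substitute the bits of \<open>x @ y\<close> for the first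
  \<open>2 * n\<close> inputs of \<open>g\<close>, and query the oracle on the resulting circuit. Substituting constants gate
  by gate preserves the positions of all gates. Since substituting the empty
  word changes nothing, both rounds are the same loop: rewrite the next circuit of the input, using
  the contents of the answer tape (blank at first) as the substituted word, query it, and append the
  answer to the output. The machine halts when the input is exhausted.
\<close>

section \<open>Hardwiring the first inputs of a circuit\<close>

fun hardwire_gate :: "bits \<Rightarrow> gate \<Rightarrow> gate" where
  "hardwire_gate xs (Inp i) = (if i < length xs then Const (xs ! i) else Inp (i - length xs))"
| "hardwire_gate xs g = g"

definition hardwire :: "bits \<Rightarrow> circuit \<Rightarrow> circuit" where
  "hardwire xs C =
     Circuit (n_inputs C - length xs) (map (hardwire_gate xs) (gates C)) (outputs C)"

lemma hardwire_gate_Nil [simp]: "hardwire_gate [] g = g"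
  by (cases g) auto

lemma hardwire_Nil [simp]: "hardwire [] C = C"
  by (cases C) (simp add: hardwire_def map_idI)

text \<open>For \<open>i \<ge> length xs\<close>, \<open>(xs @ u) ! i\<close> equals
  \<open>u ! (i - length xs)\<close> even out of range, which makes this an unconditional rewrite
  rule.\<close>

lemma gate_value_hardwire_gate [simp]:
  "gate_value u vs (hardwire_gate xs g) = gate_value (xs @ u) vs g"
  by (cases g) (auto simp: nth_append)

text \<open>Reverse induction fits because \<open>gate_values\<close> is a left fold that appends
  each new value at the end.\<close>

lemma gate_values_hardwire_gate:
  "gate_values u (map (hardwire_gate xs) gs) = gate_values (xs @ u) gs"
  by (induction gs rule: rev_induct) (simp_all add: gate_values_def)

lemma eval_circuit_hardwire: "eval_circuit (hardwire xs C) u = eval_circuit C (xs @ u)"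
  by (simp add: eval_circuit_def hardwire_def gate_values_hardwire_gate)

lemma wf_gate_hardwire_gate:
  "wf_gate (length xs + n) k g \<Longrightarrow> wf_gate n k (hardwire_gate xs g)"
  by (cases g) auto

lemma is_circuit_hardwire:
  "is_circuit (length xs + n) m C \<Longrightarrow> is_circuit n m (hardwire xs C)"
  by (auto simp: is_circuit_def hardwire_def wf_gate_hardwire_gate)


section \<open>The machine\<close>

text \<open>\<open>Rewind\<close> and \<open>RewindAnswer\<close> both return the answer head to
  cell 0 but hand over to \<open>Gates\<close> and \<open>Size\<close> respectively.
  \<open>LastIndex\<close> serves \<open>Not\<close> as well as the second operand of
  \<open>And\<close> and \<open>Or\<close>.\<close>

datatype phase = Size | Halt | Rewind | Gates | Outputs | Tag | TagF | TagT | ConstBit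
  | InpIndex | InpRest | InpBit | LastIndex | BinaryTag | FirstIndex | OutputIndex
  | Query | Answer | RewindAnswer

fun phase_index :: "phase \<Rightarrow> nat" where
  "phase_index Size = 0"
| "phase_index Halt = 1"
| "phase_index Rewind = 2"
| "phase_index Gates = 3"
| "phase_index Outputs = 4"
| "phase_index Tag = 5"
| "phase_index TagF = 6"
| "phase_index TagT = 7"
| "phase_index ConstBit = 8"
| "phase_index InpIndex = 9"
| "phase_index InpRest = 10"
| "phase_index InpBit = 11"
| "phase_index LastIndex = 12"
| "phase_index BinaryTag = 13"
| "phase_index FirstIndex = 14"
| "phase_index OutputIndex = 15"
| "phase_index Query = 16"
| "phase_index Answer = 17"
| "phase_index RewindAnswer = 18"

lemma inj_phase_index: "inj phase_index"
proof (rule injI)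
  fix p q assume "phase_index p = phase_index q"
  then show "p = q" by (cases p; cases q) simp_all
qed

declare phase_index.simps [simp del]

text \<open>With the equations of \<open>phase_index\<close> out of the simplifier, states stay
  symbolic and are compared as phases.\<close>

lemma phase_index_eq_iff [simp]: "phase_index p = phase_index q \<longleftrightarrow> p = q"
  using inj_phase_index by (auto dest: injD)

lemma phase_index_less: "phase_index p < 19"
  by (cases p) (simp_all add: phase_index.simps)

text \<open>
  An instruction consists of the next phase, whether to advance on the input, a bit to append to
  the query, the move on the answer tape, and a bit to append to the output.
\<close>

type_synonym instruction = "phase \<times> bool \<times> bool option \<times> move \<times> bool option"

definition copy_bit :: "bool \<Rightarrow> phase \<Rightarrow> instruction" where
  "copy_bit b p = (p, True, Some b, Stay, None)"

text \<open>
  The arguments are the symbols under the heads of the input and answer tapes, \<^term>\<open>None\<close> being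
  the blank. The answer head counts along while the unary index of an input gate (or the number of
  inputs) is read; if it reaches the blank, the index minus the length of the answer remains on the
  input.
\<close>

fun control :: "phase \<Rightarrow> bool option \<Rightarrow> bool option \<Rightarrow> instruction" where
  "control Size i a =
     (if i = None then (Halt, False, None, Stay, None)
      else if a = None then
        (if the i then Size else Rewind, True, i, if the i then Stay else MoveLeft, None)
      else (Size, True, None, MoveRight, None))"
| "control Rewind i a =
     (if a = None then (Gates, False, None, MoveRight, None)
      else (Rewind, False, None, MoveLeft, None))"
| "control Gates i a = copy_bit (the i) (if the i then Tag else Outputs)"
| "control Tag i a = copy_bit (the i) (if the i then TagT else TagF)"
| "control TagF i a =
     (if the i then copy_bit True ConstBit else (InpIndex, True, None, Stay, None))"
| "control TagT i a = copy_bit (the i) (if the i then BinaryTag else LastIndex)"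
| "control ConstBit i a = copy_bit (the i) Gates"
| "control InpIndex i a =
     (if a = None then (InpRest, False, Some False, Stay, None)
      else if the i then (InpIndex, True, None, MoveRight, None)
      else (InpBit, False, Some True, Stay, None))"
| "control InpRest i a =
     (if the i then InpRest else Rewind, True, i, if the i then Stay else MoveLeft, None)"
| "control InpBit i a = (Rewind, True, a, MoveLeft, None)"
| "control BinaryTag i a = copy_bit (the i) FirstIndex"
| "control FirstIndex i a = copy_bit (the i) (if the i then FirstIndex else LastIndex)"
| "control LastIndex i a = copy_bit (the i) (if the i then LastIndex else Gates)"
| "control Outputs i a = copy_bit (the i) (if the i then OutputIndex else Query)"
| "control OutputIndex i a = copy_bit (the i) (if the i then OutputIndex else Outputs)"
| "control Answer i a =
     (if a = None then (RewindAnswer, False, None, MoveLeft, None)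
      else (Answer, False, None, MoveRight, a))"
| "control RewindAnswer i a =
     (if a = None then (Size, False, None, MoveRight, None)
      else (RewindAnswer, False, None, MoveLeft, None))"
| "control Halt i a = (Halt, False, None, Stay, None)"
| "control Query i a = (Halt, False, None, Stay, None)"

definition symbol_bit :: "nat \<Rightarrow> bool option" where
  "symbol_bit s = (if s = 0 then None else Some (s = 2))"

text \<open>\<open>None\<close> rewrites the scanned symbol \<open>s\<close> in place, so the tape
  is left as it was.\<close>

definition append_action :: "nat \<Rightarrow> bool option \<Rightarrow> nat \<times> move" where
  "append_action s b = (case b of None \<Rightarrow> (s, Stay) | Some b \<Rightarrow> (bit_symbol b, MoveRight))"

definition machine_delta :: "nat \<Rightarrow> nat list \<Rightarrow> nat \<times> (nat \<times> move) list" where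
  "machine_delta q ss =
     (let (p, adv, qw, am, ow) =
        control (inv phase_index q) (symbol_bit (ss ! 0)) (symbol_bit (ss ! 2))
      in (phase_index p,
          [(ss ! 0, if adv then MoveRight else Stay), append_action (ss ! 1) qw,
           (ss ! 2, am), append_action (ss ! 3) ow]))"

definition machine :: oracle_tm where
  "machine = \<lparr> n_tapes = 4, n_states = 19, alphabet_size = 3,
     start_state = phase_index Size, query_state = phase_index Query,
     answer_state = phase_index Answer, halt_state = phase_index Halt,
     delta = machine_delta \<rparr>"

lemma append_action_less: "s < 3 \<Longrightarrow> fst (append_action s b) < 3"
  by (auto simp: append_action_def bit_symbol_def split: option.split)

text \<open>The bounds hold for every \<open>q\<close>, since the next state is always some
  \<open>phase_index p\<close>, and every symbol written is either the scanned one or a bit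
  symbol.\<close>

lemma wf_machine: "wf_oracle_tm machine"
proof -
  have "fst (machine_delta q ss) < 19 \<and> length (snd (machine_delta q ss)) = 4 \<and>
      (\<forall>(s, d) \<in> set (snd (machine_delta q ss)). s < 3)"
    if "length ss = 4" "\<forall>s \<in> set ss. s < 3" for q ss
  proof -
    have ss: "ss ! 0 < 3" "ss ! 1 < 3" "ss ! 2 < 3" "ss ! 3 < 3"
      using that by simp_all
    show ?thesis
      using ss append_action_less[OF ss(2)] append_action_less[OF ss(4)]
      by (auto simp: machine_delta_def phase_index_less split: prod.split)
        (metis fst_conv)+
  qed
  then show ?thesis
    unfolding wf_oracle_tm_def by (simp add: machine_def phase_index_less) blast
qed


section \<open>Configurations and runs\<close>

text \<open>\<open>tape_of_bits\<close> puts the head on cell 0; its contents alone can be paired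
  with any head position.\<close>

definition cell :: "bits \<Rightarrow> int \<Rightarrow> nat" where
  "cell w = fst (tape_of_bits w)"

lemma tape_of_bits_eq: "tape_of_bits w = (cell w, 0)"
  by (simp add: cell_def tape_of_bits_def)

lemma cell_eq: "cell w i = (if 0 \<le> i \<and> i < int (length w) then bit_symbol (w ! nat i) else 0)"
  by (simp add: cell_def tape_of_bits_def)

text \<open>\<open>None\<close> on both sides of the word: this is how a right scan detects the end
  and a rewind detects cell -1.\<close>

definition bit_at :: "bits \<Rightarrow> int \<Rightarrow> bool option" where
  "bit_at w i = (if 0 \<le> i \<and> i < int (length w) then Some (w ! nat i) else None)"

lemma symbol_bit_cell [simp]: "symbol_bit (cell w i) = bit_at w i"
  by (simp add: cell_eq bit_at_def symbol_bit_def bit_symbol_def)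

lemma cell_append: "(cell w)(int (length w) := bit_symbol b) = cell (w @ [b])"
  by (rule ext) (auto simp: cell_eq nth_append)

lemma bits_of_tape_cell [simp]: "bits_of_tape (cell w, i) = w"
proof -
  have range: "s \<in> range bit_symbol \<longleftrightarrow> s = 1 \<or> s = 2" for s
    by (auto simp: bit_symbol_def image_iff)
  have "(LEAST k. cell w (int k) \<notin> range bit_symbol) = length w"
    by (rule Least_equality)
      (auto simp: range cell_eq bit_symbol_def not_less[symmetric] split: if_splits)
  then show ?thesis
    by (auto simp: bits_of_tape_def cell_eq bit_symbol_def intro!: nth_equalityI)
qed

text \<open>
  In \<open>config_of p pre rest qs xs j out\<close> the input head stands between \<open>pre\<close> and \<open>rest\<close>, the answer
  head at cell \<open>j\<close>, and the heads of the query and output tapes behind the words written so far.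
\<close>

definition config_of :: "phase \<Rightarrow> bits \<Rightarrow> bits \<Rightarrow> bits \<Rightarrow> bits \<Rightarrow> int \<Rightarrow> bits \<Rightarrow> config" where
  "config_of p pre rest qs xs j out =
     (phase_index p,
      [(cell (pre @ rest), int (length pre)), (cell qs, int (length qs)), (cell xs, j),
       (cell out, int (length out))])"

definition opt_list :: "'a option \<Rightarrow> 'a list" where
  "opt_list b = (case b of None \<Rightarrow> [] | Some b \<Rightarrow> [b])"

lemma opt_list_simps [simp]: "opt_list None = []" "opt_list (Some b) = [b]"
  by (simp_all add: opt_list_def)

definition input_bit :: "bits \<Rightarrow> bool option" where
  "input_bit r = (case r of [] \<Rightarrow> None | b # _ \<Rightarrow> Some b)"

lemma input_bit_simps [simp]: "input_bit [] = None" "input_bit (b # r) = Some b"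
  by (simp_all add: input_bit_def)

lemma bit_at_append_length [simp]: "bit_at (pre @ rest) (int (length pre)) = input_bit rest"
  by (cases rest) (auto simp: bit_at_def)

lemma act_append_action:
  "act (cell w, int (length w)) (append_action (cell w (int (length w))) b) =
   (cell (w @ opt_list b), int (length (w @ opt_list b)))"
  by (cases b) (simp_all add: act_def append_action_def cell_append)

text \<open>Transfers one machine step to the level of \<open>control\<close>; all later runs rest
  on it. Advancing needs a nonempty \<open>rest\<close>, as the head must stay at the border between
  \<open>pre\<close> and \<open>rest\<close>.\<close>

lemma step_config_of:
  assumes "p \<noteq> Halt" "p \<noteq> Query"
    and "control p (input_bit rest) (bit_at xs j) = (p', adv, qw, am, ow)"
    and "adv \<Longrightarrow> rest \<noteq> []"
  shows "step machine \<O> (config_of p pre rest qs xs j out) =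
    config_of p' (if adv then pre @ [hd rest] else pre) (if adv then tl rest else rest)
      (qs @ opt_list qw) xs (j + move_offset am) (out @ opt_list ow)"
proof -
  have inv: "inv phase_index (phase_index p) = p"
    by (simp add: inv_f_f inj_phase_index)
  show ?thesis
    using assms
    by (auto simp: step_def config_of_def machine_def machine_delta_def inv read_symbol_def
        act_append_action simp del: length_append) (auto simp: act_def)
qed

section \<open>Reachability within a step bound\<close>

definition reach :: "(bits \<Rightarrow> bits) \<Rightarrow> nat \<Rightarrow> config \<Rightarrow> config \<Rightarrow> bool" where
  "reach \<O> t c c' \<longleftrightarrow> (\<exists>k \<le> t. (step machine \<O> ^^ k) c = c')"

lemma reach_refl: "reach \<O> t c c"
  unfolding reach_def by (intro exI[of _ 0]) simp

lemma reach_trans: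
  assumes "reach \<O> s c c'" "reach \<O> t c' c''"
  shows "reach \<O> (s + t) c c''"
proof -
  from assms obtain k l where "k \<le> s" "l \<le> t" "(step machine \<O> ^^ k) c = c'"
      "(step machine \<O> ^^ l) c' = c''"
    by (auto simp: reach_def)
  then show ?thesis
    \<comment> \<open>\<open>funpow_add\<close> applies the right summand first, hence
      \<open>l + k\<close> rather than \<open>k + l\<close>.\<close>
    unfolding reach_def by (intro exI[of _ "l + k"]) (simp add: funpow_add)
qed

lemma reach_mono: "reach \<O> s c c' \<Longrightarrow> s \<le> t \<Longrightarrow> reach \<O> t c c'"
  unfolding reach_def using le_trans by blast

lemma reach_step: "step machine \<O> c = c' \<Longrightarrow> reach \<O> 1 c c'"
  unfolding reach_def by (intro exI[of _ 1]) simp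

section \<open>Single steps and the elementary loops: copying, rewinding, skipping\<close>

lemma reach_stay:
  assumes "p \<noteq> Halt" "p \<noteq> Query"
    and "control p (input_bit r) (bit_at xs j) = (p', False, qw, am, ow)"
  shows "reach \<O> 1 (config_of p pre r qs xs j out)
    (config_of p' pre r (qs @ opt_list qw) xs (j + move_offset am) (out @ opt_list ow))"
  by (rule reach_step) (use step_config_of[OF assms] in simp)

lemma reach_advance:
  assumes "p \<noteq> Halt" "p \<noteq> Query"
    and "control p (Some b) (bit_at xs j) = (p', True, qw, am, ow)"
  shows "reach \<O> 1 (config_of p pre (b # r) qs xs j out)
    (config_of p' (pre @ [b]) r (qs @ opt_list qw) xs (j + move_offset am) (out @ opt_list ow))"
  by (rule reach_step) (use step_config_of[of p "b # r"] assms in simp)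

lemma reach_copy_bit:
  assumes "p \<noteq> Halt" "p \<noteq> Query"
    and "control p (Some b) (bit_at xs j) = copy_bit b p'"
  shows "reach \<O> 1 (config_of p pre (b # r) qs xs j out)
    (config_of p' (pre @ [b]) r (qs @ [b]) xs j out)"
  using reach_advance[of p b xs j p' "Some b" Stay None] assms by (simp add: copy_bit_def)

text \<open>The phase \<open>p\<close> loops on \<open>True\<close> and leaves on the final
  \<open>False\<close>. Only that last step may move the answer head, so one value
  \<open>bit_at xs j\<close> governs the whole loop.\<close>

lemma reach_copy_nat:
  assumes "p \<noteq> Halt" "p \<noteq> Query"
    and "\<And>b. control p (Some b) (bit_at xs j) =
      (if b then p else p', True, Some b, if b then Stay else am, None)"
  shows "reach \<O> (i + 1) (config_of p pre (encode_nat i @ r) qs xs j out)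
    (config_of p' (pre @ encode_nat i) r (qs @ encode_nat i) xs (j + move_offset am) out)"
proof (induction i arbitrary: pre qs)
  case 0
  show ?case
    using reach_advance[OF assms(1,2) assms(3)[of False]] by (simp add: encode_nat_def)
next
  case (Suc i)
  have "reach \<O> 1 (config_of p pre (True # encode_nat i @ r) qs xs j out)
      (config_of p (pre @ [True]) (encode_nat i @ r) (qs @ [True]) xs j out)"
    using reach_advance[OF assms(1,2) assms(3)[of True]] by simp
  from reach_trans[OF this Suc.IH] show ?case
    by (simp add: encode_nat_def)
qed

lemma reach_copy_nat_stay:
  assumes "p \<noteq> Halt" "p \<noteq> Query"
    and "\<And>b. control p (Some b) (bit_at xs j) = copy_bit b (if b then p else p')"
  shows "reach \<O> (i + 1) (config_of p pre (encode_nat i @ r) qs xs j out)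
    (config_of p' (pre @ encode_nat i) r (qs @ encode_nat i) xs j out)"
  using reach_copy_nat[of p xs j p' Stay] assms by (simp add: copy_bit_def)

text \<open>From cell \<open>m - 1\<close> the head makes \<open>m\<close> moves left to the blank
  at -1, then one move right. For \<open>m = 0\<close> it starts on that blank.\<close>

lemma reach_rewind:
  assumes "p \<noteq> Halt" "p \<noteq> Query"
    and "\<And>i b. control p i (Some b) = (p, False, None, MoveLeft, None)"
    and "\<And>i. control p i None = (p', False, None, MoveRight, None)"
    and "m \<le> length xs"
  shows "reach \<O> (m + 1) (config_of p pre r qs xs (int m - 1) out) (config_of p' pre r qs xs 0 out)"
  using assms(5)
proof (induction m)
  case 0
  show ?case
    using reach_stay[OF assms(1,2), of r xs "-1" p' None MoveRight None] assms(4)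
    by (simp add: bit_at_def)
next
  case (Suc m)
  then have "bit_at xs (int (Suc m) - 1) = Some (xs ! m)"
    by (simp add: bit_at_def)
  then have "reach \<O> 1 (config_of p pre r qs xs (int (Suc m) - 1) out)
      (config_of p pre r qs xs (int m - 1) out)"
    using reach_stay[OF assms(1,2), of r xs "int (Suc m) - 1" p None MoveLeft None] assms(3) by simp
  from reach_trans[OF this Suc.IH] Suc.prems show ?case by simp
qed

text \<open>Input and answer heads advance in lockstep and nothing is written: this is how
  \<open>k\<close> is subtracted from a unary number.\<close>

lemma reach_skip:
  assumes "p \<noteq> Halt" "p \<noteq> Query"
    and "\<And>b. control p (Some True) (Some b) = (p, True, None, MoveRight, None)"
    and "k \<le> length xs"
  shows "reach \<O> k (config_of p pre (replicate k True @ r) qs xs 0 out)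
    (config_of p (pre @ replicate k True) r qs xs (int k) out)"
  using assms(4)
proof (induction k arbitrary: r)
  case 0
  show ?case by (simp add: reach_refl)
next
  case (Suc k)
  then have "bit_at xs (int k) = Some (xs ! k)"
    by (simp add: bit_at_def)
  then have "reach \<O> 1 (config_of p (pre @ replicate k True) (True # r) qs xs (int k) out)
      (config_of p (pre @ replicate (Suc k) True) r qs xs (int (Suc k)) out)"
    using reach_advance[OF assms(1,2), of True xs "int k" p None MoveRight None
        _ "pre @ replicate k True"] assms(3)
    by (simp add: replicate_append_same[symmetric] add.commute)
  \<comment> \<open>The last \<open>True\<close> is peeled off, so the induction hypothesis is taken
    with it in front of \<open>r\<close>.\<close>
  from reach_trans[OF Suc.IH[of "True # r"] this] Suc.prems
  show ?case by (simp add: replicate_app_Cons_same)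
qed

lemma encode_nat_split: "k \<le> i \<Longrightarrow> encode_nat i = replicate k True @ encode_nat (i - k)"
  by (simp add: encode_nat_def replicate_add[symmetric])


section \<open>Rewriting a circuit\<close>

lemma bit_at_length [simp]: "bit_at xs (int (length xs)) = None"
  by (simp add: bit_at_def)

text \<open>Skipping \<open>length xs\<close> ones, copying what remains and rewinding subtracts the
  number of hardwired inputs.\<close>

lemma reach_size:
  assumes "length xs \<le> m"
  shows "reach \<O> (m + length xs + 2) (config_of Size pre (encode_nat m @ r) qs xs 0 out)
    (config_of Gates (pre @ encode_nat m) r (qs @ encode_nat (m - length xs)) xs 0 out)"
proof -
  let ?k = "length xs"
  have 1: "reach \<O> ?k (config_of Size pre (replicate ?k True @ encode_nat (m - ?k) @ r) qs xs 0 out)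
    (config_of Size (pre @ replicate ?k True) (encode_nat (m - ?k) @ r) qs xs (int ?k) out)"
    by (rule reach_skip) auto
  have 2: "reach \<O> (m - ?k + 1)
    (config_of Size (pre @ replicate ?k True) (encode_nat (m - ?k) @ r) qs xs (int ?k) out)
    (config_of Rewind ((pre @ replicate ?k True) @ encode_nat (m - ?k)) r
       (qs @ encode_nat (m - ?k)) xs (int ?k - 1) out)"
    using reach_copy_nat[of Size xs "int ?k" Rewind MoveLeft] by (simp del: append_assoc)
  have 3: "reach \<O> (?k + 1)
    (config_of Rewind ((pre @ replicate ?k True) @ encode_nat (m - ?k)) r
       (qs @ encode_nat (m - ?k)) xs (int ?k - 1) out)
    (config_of Gates ((pre @ replicate ?k True) @ encode_nat (m - ?k)) r
       (qs @ encode_nat (m - ?k)) xs 0 out)"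
    by (rule reach_rewind) auto
  show ?thesis
    using reach_trans[OF reach_trans[OF 1 2] 3] assms
    by (simp add: encode_nat_split[OF assms])
qed

text \<open>The query ends in \<open>[False]\<close> only: the second tag bit is withheld until it
  is known whether the answer head meets the blank, which decides between \<open>Inp\<close> and
  \<open>Const\<close>.\<close>

lemma reach_inp_index:
  "reach \<O> (i + length xs + 3) (config_of InpIndex pre (encode_nat i @ r) (qs @ [False]) xs 0 out)
    (config_of Gates (pre @ encode_nat i) r (qs @ encode_gate (hardwire_gate xs (Inp i))) xs 0 out)"
proof (cases "i < length xs")
  case True
  have at: "bit_at xs (int i) = Some (xs ! i)"
    using True by (simp add: bit_at_def)
  have 1: "reach \<O> i
    (config_of InpIndex pre (replicate i True @ False # r) (qs @ [False]) xs 0 out)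
    (config_of InpIndex (pre @ replicate i True) (False # r) (qs @ [False]) xs (int i) out)"
    by (rule reach_skip) (use True in auto)
  have 2: "reach \<O> 1
    (config_of InpIndex (pre @ replicate i True) (False # r) (qs @ [False]) xs (int i) out)
    (config_of InpBit (pre @ replicate i True) (False # r) (qs @ [False, True]) xs (int i) out)"
    using reach_stay[of InpIndex "False # r" xs "int i" InpBit "Some True" Stay None _ _ "qs @ [False]"]
    by (simp add: at)
  \<comment> \<open>The terminating \<open>False\<close> of the index is consumed while the bit
    under the answer head is written as the constant.\<close>
  have 3: "reach \<O> 1
    (config_of InpBit (pre @ replicate i True) (False # r) (qs @ [False, True]) xs (int i) out)
    (config_of Rewind (pre @ encode_nat i) r (qs @ [False, True, xs ! i]) xs (int i - 1) out)"
    using reach_advance[of InpBit False xs "int i" Rewind "Some (xs ! i)" MoveLeft None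
        _ "pre @ replicate i True" r "qs @ [False, True]" out]
    by (simp add: at encode_nat_def)
  have 4: "reach \<O> (i + 1)
    (config_of Rewind (pre @ encode_nat i) r (qs @ [False, True, xs ! i]) xs (int i - 1) out)
    (config_of Gates (pre @ encode_nat i) r (qs @ [False, True, xs ! i]) xs 0 out)"
    by (rule reach_rewind) (use True in auto)
  \<comment> \<open>The run takes at most \<open>2 * i + 3\<close> steps, within the bound because
    \<open>i < length xs\<close>.\<close>
  from reach_trans[OF reach_trans[OF reach_trans[OF 1 2] 3] 4] True
  show ?thesis by (auto simp: encode_nat_def elim!: reach_mono)
next
  case False
  let ?k = "length xs"
  have 1: "reach \<O> ?k
    (config_of InpIndex pre (replicate ?k True @ encode_nat (i - ?k) @ r) (qs @ [False]) xs 0 out)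
    (config_of InpIndex (pre @ replicate ?k True) (encode_nat (i - ?k) @ r) (qs @ [False]) xs (int ?k) out)"
    by (rule reach_skip) auto
  have 2: "reach \<O> 1
    (config_of InpIndex (pre @ replicate ?k True) (encode_nat (i - ?k) @ r) (qs @ [False]) xs (int ?k) out)
    (config_of InpRest (pre @ replicate ?k True) (encode_nat (i - ?k) @ r) (qs @ [False, False]) xs (int ?k) out)"
    using reach_stay[of InpIndex _ xs "int ?k" InpRest "Some False" Stay None _ _ "qs @ [False]"]
    by simp
  have 3: "reach \<O> (i - ?k + 1)
    (config_of InpRest (pre @ replicate ?k True) (encode_nat (i - ?k) @ r) (qs @ [False, False]) xs (int ?k) out)
    (config_of Rewind ((pre @ replicate ?k True) @ encode_nat (i - ?k)) r
       ((qs @ [False, False]) @ encode_nat (i - ?k)) xs (int ?k - 1) out)"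
    using reach_copy_nat[of InpRest xs "int ?k" Rewind MoveLeft] by (simp del: append_assoc)
  have 4: "reach \<O> (?k + 1)
    (config_of Rewind ((pre @ replicate ?k True) @ encode_nat (i - ?k)) r
       ((qs @ [False, False]) @ encode_nat (i - ?k)) xs (int ?k - 1) out)
    (config_of Gates ((pre @ replicate ?k True) @ encode_nat (i - ?k)) r
       ((qs @ [False, False]) @ encode_nat (i - ?k)) xs 0 out)"
    by (rule reach_rewind) auto
  have "encode_nat i = replicate ?k True @ encode_nat (i - ?k)"
    using False by (intro encode_nat_split) simp
  with reach_trans[OF reach_trans[OF reach_trans[OF 1 2] 3] 4] False
  show ?thesis by (auto elim!: reach_mono)
qed

lemma length_encode_nat [simp]: "length (encode_nat n) = n + 1"
  by (simp add: encode_nat_def)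

text \<open>A budget of \<open>length xs + 3\<close> steps per code bit is generous, but it covers
  the rewind after an \<open>Inp\<close> gate and adds up over the gate list. The leading
  \<open>True\<close> is the list marker of \<open>encode_list\<close>.\<close>

lemma reach_gate:
  "reach \<O> (length (True # encode_gate g) * (length xs + 3))
    (config_of Gates pre (True # encode_gate g @ r) qs xs 0 out)
    (config_of Gates (pre @ True # encode_gate g) r
       (qs @ True # encode_gate (hardwire_gate xs g)) xs 0 out)"
proof -
  note bit = reach_copy_bit[where xs = xs and j = 0 and out = out and \<O> = \<O>]
  note nat = reach_copy_nat_stay[where xs = xs and j = 0 and out = out and \<O> = \<O>]
  have tag: "reach \<O> 1 (config_of Gates pre (True # e) qs xs 0 out)
      (config_of Tag (pre @ [True]) e (qs @ [True]) xs 0 out)" for e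
    by (rule bit) (auto simp: copy_bit_def)
  have tagF: "reach \<O> 2 (config_of Gates pre (True # False # e) qs xs 0 out)
      (config_of TagF (pre @ [True, False]) e (qs @ [True, False]) xs 0 out)" for e
    using reach_trans[OF tag bit[of Tag False TagF "pre @ [True]" e "qs @ [True]", simplified]]
    by (simp add: numeral_2_eq_2)
  have tagT: "reach \<O> 2 (config_of Gates pre (True # True # e) qs xs 0 out)
      (config_of TagT (pre @ [True, True]) e (qs @ [True, True]) xs 0 out)" for e
    using reach_trans[OF tag bit[of Tag True TagT "pre @ [True]" e "qs @ [True]", simplified]]
    by (simp add: numeral_2_eq_2)
  \<comment> \<open>\<open>And\<close> and \<open>Or\<close> differ only in the third tag bit
    \<open>b\<close>, so one run covers both.\<close>
  have binary: "reach \<O> (i + j + 6)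
      (config_of Gates pre (True # True # True # b # encode_nat i @ encode_nat j @ r) qs xs 0 out)
      (config_of Gates (pre @ True # True # True # b # encode_nat i @ encode_nat j) r
         (qs @ True # True # True # b # encode_nat i @ encode_nat j) xs 0 out)" for b i j
    using reach_trans[OF reach_trans[OF reach_trans[OF reach_trans[OF tagT
      bit[of TagT True BinaryTag "pre @ [True, True]" _ "qs @ [True, True]", simplified]]
      bit[of BinaryTag b FirstIndex "pre @ [True, True, True]" _ "qs @ [True, True, True]", simplified]]
      nat[of FirstIndex LastIndex i "pre @ [True, True, True, b]" _ "qs @ [True, True, True, b]", simplified]]
      nat[of LastIndex Gates j "pre @ [True, True, True, b] @ encode_nat i" r
        "qs @ [True, True, True, b] @ encode_nat i", simplified]]
    by (auto elim!: reach_mono)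
  show ?thesis
  proof (cases g)
    case (Inp i)
    \<comment> \<open>The second tag bit is read but not written, as \<open>reach_inp_index\<close>
      expects.\<close>
    have "reach \<O> 1 (config_of TagF (pre @ [True, False]) (False # encode_nat i @ r) (qs @ [True, False]) xs 0 out)
      (config_of InpIndex (pre @ [True, False, False]) (encode_nat i @ r) (qs @ [True, False]) xs 0 out)"
      using reach_advance[of TagF False xs 0 InpIndex None Stay None _ "pre @ [True, False]"] by simp
    from reach_trans[OF reach_trans[OF tagF this]
      reach_inp_index[of _ _ _ "pre @ [True, False, False]" _ "qs @ [True]",
        unfolded append_assoc append_Cons append_Nil]]
    have "reach \<O> (i + length xs + 6) (config_of Gates pre (True # encode_gate g @ r) qs xs 0 out)
        (config_of Gates (pre @ True # encode_gate g) r
          (qs @ True # encode_gate (hardwire_gate xs g)) xs 0 out)"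
      by (simp add: Inp reach_mono)
    then show ?thesis
      by (rule reach_mono) (simp add: Inp algebra_simps)
  next
    case (Const b)
    show ?thesis
      using reach_trans[OF reach_trans[OF tagF
        bit[of TagF True ConstBit "pre @ [True, False]" _ "qs @ [True, False]", simplified]]
        bit[of ConstBit b Gates "pre @ [True, False, True]" r "qs @ [True, False, True]", simplified]]
      by (auto simp: Const elim!: reach_mono)
  next
    case (Not i)
    show ?thesis
      using reach_trans[OF reach_trans[OF tagT
        bit[of TagT False LastIndex "pre @ [True, True]" _ "qs @ [True, True]", simplified]]
        nat[of LastIndex Gates i "pre @ [True, True, False]" r "qs @ [True, True, False]", simplified]]
      by (auto simp: Not algebra_simps elim!: reach_mono)
  next
    case (And i j)
    show ?thesis
      using binary[of i j False] by (auto simp: And algebra_simps elim!: reach_mono)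
  next
    case (Or i j)
    show ?thesis
      using binary[of i j True] by (auto simp: Or algebra_simps elim!: reach_mono)
  qed
qed


lemma encode_list_simps [simp]:
  "encode_list e [] = [False]"
  "encode_list e (x # xs) = True # e x @ encode_list e xs"
  by (simp_all add: encode_list_def)

lemma reach_gates:
  "reach \<O> (length (encode_list encode_gate gs) * (length xs + 3))
    (config_of Gates pre (encode_list encode_gate gs @ r) qs xs 0 out)
    (config_of Outputs (pre @ encode_list encode_gate gs) r
       (qs @ encode_list encode_gate (map (hardwire_gate xs) gs)) xs 0 out)"
proof (induction gs arbitrary: pre qs)
  case Nil
  have "reach \<O> 1 (config_of Gates pre (False # r) qs xs 0 out)
      (config_of Outputs (pre @ [False]) r (qs @ [False]) xs 0 out)"
    by (rule reach_copy_bit) auto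
  then show ?case by (auto elim!: reach_mono)
next
  case (Cons g gs)
  show ?case
    using reach_trans[OF reach_gate[of \<O> g xs pre "encode_list encode_gate gs @ r" qs out] Cons.IH]
    by (simp add: algebra_simps)
qed

text \<open>Outputs are gate positions, which hardwiring preserves, so they are copied
  verbatim.\<close>

lemma reach_outputs:
  "reach \<O> (length (encode_list encode_nat os))
    (config_of Outputs pre (encode_list encode_nat os @ r) qs xs 0 out)
    (config_of Query (pre @ encode_list encode_nat os) r (qs @ encode_list encode_nat os) xs 0 out)"
proof (induction os arbitrary: pre qs)
  case Nil
  have "reach \<O> 1 (config_of Outputs pre (False # r) qs xs 0 out)
      (config_of Query (pre @ [False]) r (qs @ [False]) xs 0 out)"
    by (rule reach_copy_bit) auto
  then show ?case by simp
next
  case (Cons i os)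
  let ?r = "encode_list encode_nat os @ r"
  have 1: "reach \<O> 1 (config_of Outputs pre (True # encode_nat i @ ?r) qs xs 0 out)
      (config_of OutputIndex (pre @ [True]) (encode_nat i @ ?r) (qs @ [True]) xs 0 out)"
    by (rule reach_copy_bit) auto
  have 2: "reach \<O> (i + 1)
      (config_of OutputIndex (pre @ [True]) (encode_nat i @ ?r) (qs @ [True]) xs 0 out)
      (config_of Outputs ((pre @ [True]) @ encode_nat i) ?r ((qs @ [True]) @ encode_nat i) xs 0 out)"
    by (rule reach_copy_nat_stay) auto
  from reach_trans[OF reach_trans[OF 1 2] Cons.IH] show ?case by simp
qed

lemma reach_circuit:
  assumes "length xs \<le> n_inputs C"
  shows "reach \<O> (length (encode_circuit C) * (length xs + 3))
    (config_of Size pre (encode_circuit C @ r) [] xs 0 out)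
    (config_of Query (pre @ encode_circuit C) r (encode_circuit (hardwire xs C)) xs 0 out)"
proof -
  let ?c = "length xs + 3"
  let ?n = "encode_nat (n_inputs C)" and ?gs = "encode_list encode_gate (gates C)"
    and ?os = "encode_list encode_nat (outputs C)"
  have "reach \<O> (n_inputs C + length xs + 2 + length ?gs * ?c + length ?os)
    (config_of Size pre (encode_circuit C @ r) [] xs 0 out)
    (config_of Query (pre @ encode_circuit C) r (encode_circuit (hardwire xs C)) xs 0 out)"
    using reach_trans[OF reach_trans[OF
      reach_size[OF assms, of \<O> pre "?gs @ ?os @ r" "[]" out]
      reach_gates[of \<O> "gates C" xs "pre @ ?n" "?os @ r" _ out]]
      reach_outputs[of \<O> "outputs C" "(pre @ ?n) @ ?gs" r _ xs out]]
    by (simp add: encode_circuit_def hardwire_def)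
  then show ?thesis
    by (rule reach_mono) (simp add: encode_circuit_def algebra_simps)
qed


section \<open>The reduction\<close>

text \<open>The query step itself erases the query tape and resets the answer head, which prepares
  the next round.\<close>

lemma reach_query:
  "reach \<O> 1 (config_of Query pre r qs xs j out) (config_of Answer pre r [] (\<O> qs) 0 out)"
  by (rule reach_step)
    (simp add: step_def config_of_def machine_def numeral_2_eq_2 tape_of_bits_eq)

text \<open>A pass to the right copies the answer to the output, one step turns at the blank, and a
  rewind follows. The answer stays on its tape as the word to substitute next.\<close>

lemma reach_answer:
  "reach \<O> (2 * length xs + 2) (config_of Answer pre r qs xs 0 out)
    (config_of Size pre r qs xs 0 (out @ xs))"
proof -
  have "reach \<O> k (config_of Answer pre r qs xs 0 out)
      (config_of Answer pre r qs xs (int k) (out @ take k xs))" if "k \<le> length xs" for k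
    using that
  proof (induction k)
    case 0
    show ?case by (simp add: reach_refl)
  next
    case (Suc k)
    then have "bit_at xs (int k) = Some (xs ! k)"
      by (simp add: bit_at_def)
    then have "reach \<O> 1 (config_of Answer pre r qs xs (int k) (out @ take k xs))
        (config_of Answer pre r qs xs (int (Suc k)) (out @ take (Suc k) xs))"
      using reach_stay[of Answer r xs "int k" Answer None MoveRight "Some (xs ! k)"
          \<O> pre qs "out @ take k xs"] Suc.prems
      by (simp add: take_Suc_conv_app_nth add.commute)
    from reach_trans[OF Suc.IH this] Suc.prems show ?case by simp
  qed
  from this[of "length xs"]
  have 1: "reach \<O> (length xs) (config_of Answer pre r qs xs 0 out)
      (config_of Answer pre r qs xs (int (length xs)) (out @ xs))"
    by simp
  have 2: "reach \<O> 1 (config_of Answer pre r qs xs (int (length xs)) (out @ xs))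
      (config_of RewindAnswer pre r qs xs (int (length xs) - 1) (out @ xs))"
    using reach_stay[of Answer r xs "int (length xs)" RewindAnswer None MoveLeft None] by simp
  have 3: "reach \<O> (length xs + 1)
      (config_of RewindAnswer pre r qs xs (int (length xs) - 1) (out @ xs))
      (config_of Size pre r qs xs 0 (out @ xs))"
    by (rule reach_rewind) auto
  from reach_trans[OF reach_trans[OF 1 2] 3] show ?thesis
    by (auto elim!: reach_mono)
qed

text \<open>The loop invariant: phase \<open>Size\<close>, empty query tape, answer head on cell 0.
  One round replaces the substituted word \<open>xs\<close> by the new answer
  \<open>ys\<close>.\<close>

lemma reach_round:
  assumes "length xs \<le> n_inputs C" and "\<O> (encode_circuit (hardwire xs C)) = ys"
  shows "reach \<O> (length (encode_circuit C) * (length xs + 3) + 2 * length ys + 3)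
    (config_of Size pre (encode_circuit C @ r) [] xs 0 out)
    (config_of Size (pre @ encode_circuit C) r [] ys 0 (out @ ys))"
  using reach_trans[OF reach_trans[OF reach_circuit[OF assms(1)] reach_query] reach_answer,
      of \<O> pre r out] assms(2)
  by (auto elim!: reach_mono)

lemma initial_config_machine: "initial_config machine w = config_of Size [] w [] [] 0 []"
  by (simp add: initial_config_def config_of_def machine_def tape_of_bits_eq eval_nat_numeral)

lemma computes_withinI:
  assumes "reach \<O> T (config_of Size [] w [] [] 0 []) (config_of Size w [] [] xs 0 z)"
  shows "computes_within machine \<O> w (T + 1) z"
proof -
  have "reach \<O> 1 (config_of Size w [] [] xs 0 z) (config_of Halt w [] [] xs 0 z)"
    using reach_stay[of Size "[]" xs 0 Halt None Stay None] by simp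
  from reach_trans[OF assms this] show ?thesis
    unfolding computes_within_def reach_def initial_config_machine
    by (fastforce simp: config_of_def machine_def numeral_3_eq_3)
qed

text \<open>A solution only speaks of some circuit with the queried code. Prefix-freeness with empty
  remainders makes the encoding injective, so that circuit is \<open>C\<close>, and
  \<open>n_inputs\<close> then fixes the length.\<close>

lemma oracle_for_Collision:
  assumes "is_oracle_for \<O> Collision" "1 \<le> n" "is_circuit n (n - 1) C"
  obtains x y where "\<O> (encode_circuit C) = x @ y" "length x = n" "length y = n" "x \<noteq> y"
    "eval_circuit C x = eval_circuit C y"
proof -
  have "encode_circuit C \<in> instances Collision"
    using assms(2,3) by (auto simp: Collision_def)
  then have "\<O> (encode_circuit C) \<in> solutions Collision (encode_circuit C)"
    using assms(1) by (auto simp: is_oracle_for_def)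
  then obtain m D x y where D: "is_circuit m (m - 1) D" "encode_circuit C = encode_circuit D"
      and xy: "\<O> (encode_circuit C) = x @ y" "length x = m" "length y = m" "x \<noteq> y"
        "eval_circuit D x = eval_circuit D y"
    by (auto simp: Collision_def)
  have "C = D"
    using encode_circuit_prefix_free[of C "[]" D "[]"] D(2) by simp
  moreover from this have "m = n"
    using D(1) assms(3) by (simp add: is_circuit_def)
  ultimately show thesis
    using that xy by simp
qed

lemma n_inputs_le_encode_circuit: "n_inputs C \<le> length (encode_circuit C)"
  by (simp add: encode_circuit_def)

lemma machine_solves_NestedCollision:
  assumes \<O>: "is_oracle_for \<O> Collision" and w: "w \<in> instances NestedCollision"
  shows "\<exists>z \<in> solutions NestedCollision w.
    computes_within machine \<O> w (poly [:7, 14, 2:] (length w)) z"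
proof -
  from w obtain n f g where fg: "1 \<le> n" "is_circuit n (n - 1) f" "is_circuit (2 * n + n) (n - 1) g"
      and w_eq: "w = encode_circuit f @ encode_circuit g"
    by (auto simp: NestedCollision_def)
  obtain x y where xy: "\<O> (encode_circuit f) = x @ y" "length x = n" "length y = n" "x \<noteq> y"
      "eval_circuit f x = eval_circuit f y"
    using oracle_for_Collision[OF \<O> fg(1,2)] .
  let ?g = "hardwire (x @ y) g"
  have "is_circuit n (n - 1) ?g"
    using fg(3) xy by (intro is_circuit_hardwire) (simp add: mult_2)
  then obtain u v where uv: "\<O> (encode_circuit ?g) = u @ v" "length u = n" "length v = n" "u \<noteq> v"
      "eval_circuit ?g u = eval_circuit ?g v"
    using oracle_for_Collision[OF \<O> fg(1)] by blast
  let ?z = "x @ y @ u @ v"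
  have "eval_circuit g (x @ y @ u) = eval_circuit g (x @ y @ v)"
    using uv(5) by (simp add: eval_circuit_hardwire)
  then have sol: "?z \<in> solutions NestedCollision w"
    unfolding NestedCollision_def search_problem.simps mem_Collect_eq
    using fg w_eq xy uv by blast
  let ?F = "length (encode_circuit f)" and ?G = "length (encode_circuit g)"
  \<comment> \<open>In the first round the blank answer tape is the empty word, and
    \<open>hardwire_Nil\<close> turns the query into \<open>f\<close> itself.\<close>
  have 1: "reach \<O> (?F * (length ([] :: bits) + 3) + 2 * length (x @ y) + 3)
      (config_of Size [] (encode_circuit f @ encode_circuit g) [] [] 0 [])
      (config_of Size ([] @ encode_circuit f) (encode_circuit g) [] (x @ y) 0 ([] @ x @ y))"
    by (rule reach_round) (use xy in auto)
  have 2: "reach \<O> (?G * (length (x @ y) + 3) + 2 * length (u @ v) + 3)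
      (config_of Size (encode_circuit f) (encode_circuit g @ []) [] (x @ y) 0 (x @ y))
      (config_of Size (encode_circuit f @ encode_circuit g) [] [] (u @ v) 0 ((x @ y) @ u @ v))"
    by (rule reach_round) (use xy uv fg(3) in \<open>auto simp: is_circuit_def\<close>)
  have "computes_within machine \<O> w
      (?F * 3 + 4 * n + 3 + (?G * (2 * n + 3) + 4 * n + 3) + 1) ?z"
    by (rule computes_withinI[of _ _ _ "u @ v"])
      (use reach_trans[OF 1, simplified, OF 2[simplified]] xy uv in \<open>simp add: w_eq\<close>)
  \<comment> \<open>With \<open>N = length w\<close>, the bounds \<open>?F + ?G = N\<close>,
    \<open>n \<le> N\<close> and \<open>?G * n \<le> N * N\<close> give at most
    \<open>7 + 11 * N + 2 * N * N\<close>; the coefficient 14 leaves slack.\<close>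
  moreover have "?F * 3 + 4 * n + 3 + (?G * (2 * n + 3) + 4 * n + 3) + 1 \<le> poly [:7, 14, 2:] (length w)"
  proof -
    have "n \<le> length w"
      using n_inputs_le_encode_circuit[of f] fg(2) by (simp add: is_circuit_def w_eq)
    moreover from this have "?G * n \<le> length w * length w"
      by (intro mult_le_mono) (simp_all add: w_eq)
    moreover have "?F + ?G = length w"
      by (simp add: w_eq)
    ultimately show ?thesis
      by (simp add: algebra_simps)
  qed
  ultimately have "computes_within machine \<O> w (poly [:7, 14, 2:] (length w)) ?z"
    unfolding computes_within_def using le_trans by blast
  with sol show ?thesis by blast
qed

theorem mainTheorem3: "NestedCollision \<le>\<^sub>T Collision"
  unfolding turing_reducible_def using wf_machine machine_solves_NestedCollision by blast

end
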